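(* Let $G$ be a finite group and let $H$ be a Schur cover of $G$ with kernel $Z$, so that $H/Z=G$. The deep commuting graph of $G$ is equal to the enhanced power graph of $G$ if and only if the following property holds: for any subgroup $A$ of $G$, with $B$ the corresponding subgroup of $H$ (so $Z\leqslant B$ and $B/Z=A$), if $B$ is abelian, then $A$ is cyclic.
   Context: Both graphs have vertex set $G$; equality means equality of edge sets. In the enhanced power graph, distinct $x,y\in G$ are joined if $\langle x,y\rangle$ is cyclic. A central extension of a finite group $G$ is a finite group $H$ together with a surjective homomorphism $\pi\colon H\to G$ whose kernel $Z$ satisfies $Z\leqslant Z(H)$ (one identifies $G$ with $H/Z$). It is a stem extension if $Z\leqslant Z(H)\cap H'$, where $H'$ is the derived subgroup. The Schur multiplier of $G$ is $M(G)=(R\cap F')/[R,F]$, where $G\cong F/R$ with $F$ free. A Schur cover of $G$ is a stem extension of $G$ of largest possible order, equivalently a stem extension whose kernel is isomorphic to $M(G)$. In the deep commuting graph of $G$, distinct $x,y\in G$ are joined if and only if their inverse images in a Schur cover $\pi\colon H\to G$ commute, i.e. $ab=ba$ for some (equivalently, since $\ker\pi$ is central, for all) $a\in\pi^{-1}(x)$, $b\in\pi^{-1}(y)$. This edge set is independent of the choice of Schur cover. *)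

theory Defs
  imports "HOL-Algebra.Algebra"
begin

definition group_center :: "('a, 'm) monoid_scheme \<Rightarrow> 'a set" where
  "group_center G =
     {z \<in> carrier G. \<forall>g \<in> carrier G. z \<otimes>\<^bsub>G\<^esub> g = g \<otimes>\<^bsub>G\<^esub> z}"

definition central_extension ::
  "('a, 'm) monoid_scheme \<Rightarrow> ('b, 'n) monoid_scheme \<Rightarrow> ('b \<Rightarrow> 'a) \<Rightarrow> bool" where
  "central_extension G H \<pi> \<longleftrightarrow>
     group G \<and> finite (carrier G) \<and> group H \<and> finite (carrier H) \<and>
     \<pi> \<in> epi H G \<and> kernel H G \<pi> \<subseteq> group_center H"

definition stem_extension ::
  "('a, 'm) monoid_scheme \<Rightarrow> ('b, 'n) monoid_scheme \<Rightarrow> ('b \<Rightarrow> 'a) \<Rightarrow> bool" where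
  "stem_extension G H \<pi> \<longleftrightarrow>
     central_extension G H \<pi> \<and> kernel H G \<pi> \<subseteq> group_center H \<inter> derived H (carrier H)"

text \<open>
  A definition cannot quantify over types, so the competing stem extensions are taken with
  underlying type \<^typ>\<open>nat\<close>. This loses nothing, since every finite group is
  isomorphic to one of this kind; see \<open>schur_cover_order_maximal\<close> below.
\<close>

definition schur_cover ::
  "('a, 'm) monoid_scheme \<Rightarrow> ('b, 'n) monoid_scheme \<Rightarrow> ('b \<Rightarrow> 'a) \<Rightarrow> bool" where
  "schur_cover G H \<pi> \<longleftrightarrow>
     stem_extension G H \<pi> \<and>
     (\<forall>(K :: nat monoid) \<rho>. stem_extension G K \<rho> \<longrightarrow> order K \<le> order H)"

lemma schur_cover_order_maximal:
  fixes G :: "('a, 'm) monoid_scheme" and H :: "('b, 'n) monoid_scheme"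
    and K :: "('c, 'k) monoid_scheme"
  assumes "schur_cover G H \<pi>" and "stem_extension G K \<rho>"
  shows "order K \<le> order H"
proof -
  have K: "group K" "finite (carrier K)" "group G" "finite (carrier G)"
    and \<rho>: "\<rho> \<in> hom K G" "\<rho> ` carrier K = carrier G"
    and ker: "kernel K G \<rho> \<subseteq> group_center K \<inter> derived K (carrier K)"
    using assms(2) by (auto simp: stem_extension_def central_extension_def epi_def)
  interpret K: group K by (fact K)
  obtain f :: "'c \<Rightarrow> nat" where f: "inj_on f (carrier K)"
    using finite_imp_inj_to_nat_seg[OF K(2)] by blast
  define g where "g = inv_into (carrier K) f"
  have gf [simp]: "g (f x) = x" if "x \<in> carrier K" for x
    using that f by (simp add: g_def)
  define L :: "nat monoid" where
    "L = \<lparr>carrier = f ` carrier K, monoid.mult = (\<lambda>a b. f (g a \<otimes>\<^bsub>K\<^esub> g b)), one = f \<one>\<^bsub>K\<^esub>\<rparr>"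
  have carL: "carrier L = f ` carrier K" by (simp add: L_def)
  have multL: "f x \<otimes>\<^bsub>L\<^esub> f y = f (x \<otimes>\<^bsub>K\<^esub> y)" if "x \<in> carrier K" "y \<in> carrier K" for x y
    using that by (simp add: L_def)
  have oneL: "\<one>\<^bsub>L\<^esub> = f \<one>\<^bsub>K\<^esub>" by (simp add: L_def)
  have grpL: "group L"
  proof (rule groupI)
    fix x assume "x \<in> carrier L"
    then obtain y where y: "y \<in> carrier K" "x = f y" by (auto simp: carL)
    show "\<exists>z\<in>carrier L. z \<otimes>\<^bsub>L\<^esub> x = \<one>\<^bsub>L\<^esub>"
      using y by (intro bexI[of _ "f (inv\<^bsub>K\<^esub> y)"]) (auto simp: carL oneL multL)
  qed (auto simp: carL multL oneL K.m_assoc)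
  have fhom: "f \<in> hom K L" by (auto simp: hom_def carL multL)
  interpret fh: group_hom K L f
    using K(1) grpL fhom by (simp add: group_hom_def group_hom_axioms_def)
  have der: "derived L (carrier L) = f ` derived K (carrier K)"
    using fh.derived_img[of "carrier K"] by (simp add: carL)
  have "stem_extension G L (\<rho> \<circ> g)"
    unfolding stem_extension_def central_extension_def epi_def
  proof (intro conjI CollectI)
    have "g \<in> hom L K" by (auto simp: hom_def carL simp flip: fh.hom_mult)
    then show "\<rho> \<circ> g \<in> hom L G"
      using \<rho>(1) by (rule hom_compose)
    have "g ` carrier L = carrier K" by (force simp: carL image_comp)
    then show "(\<rho> \<circ> g) ` carrier L = carrier G"
      using \<rho>(2) by (metis image_comp)
    have "kernel L G (\<rho> \<circ> g) = f ` kernel K G \<rho>"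
      by (auto simp: kernel_def carL)
    moreover have "f ` group_center K \<subseteq> group_center L"
      by (auto simp: group_center_def carL simp flip: fh.hom_mult)
    ultimately show "kernel L G (\<rho> \<circ> g) \<subseteq> group_center L"
      and "kernel L G (\<rho> \<circ> g) \<subseteq> group_center L \<inter> derived L (carrier L)"
      using ker der by blast+
  qed (use K grpL carL in auto)
  then have "order L \<le> order H"
    using assms(1) unfolding schur_cover_def by blast
  then show ?thesis
    using f by (simp add: order_def carL card_image)
qed

text \<open>
  Both graphs have vertex set \<open>carrier G\<close> and are represented by their edge sets.
  The cover used to define the deep commuting graph is an explicit argument; the edge set
  does not depend on which Schur cover is chosen.
\<close>

definition deep_commuting_graph ::
  "('a, 'm) monoid_scheme \<Rightarrow> ('b, 'n) monoid_scheme \<Rightarrow> ('b \<Rightarrow> 'a) \<Rightarrow> 'a set set" where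
  "deep_commuting_graph G H \<pi> =
     {{x, y} | x y. x \<in> carrier G \<and> y \<in> carrier G \<and> x \<noteq> y \<and>
        (\<exists>a \<in> carrier H. \<exists>b \<in> carrier H.
           \<pi> a = x \<and> \<pi> b = y \<and> a \<otimes>\<^bsub>H\<^esub> b = b \<otimes>\<^bsub>H\<^esub> a)}"

definition enhanced_power_graph :: "('a, 'm) monoid_scheme \<Rightarrow> 'a set set" where
  "enhanced_power_graph G =
     {{x, y} | x y. x \<in> carrier G \<and> y \<in> carrier G \<and> x \<noteq> y \<and>
        cyclic_group (subgroup_generated G {x, y})}"

end

theory Submission
  imports Defs
begin

text \<open>
  Say that the lifts of \<open>x, y \<in> G\<close> commute if some, equivalently all, of their preimages in \<open>H\<close>
  commute; the equivalence holds because two preimages of one element differ by an element of the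
  central kernel. For fixed \<open>y\<close>, the elements \<open>x\<close> whose lifts commute with those of \<open>y\<close> form a
  subgroup of \<open>G\<close>, namely the image of a centralizer in \<open>H\<close>. Hence, if the elements of a set have
  pairwise commuting lifts, so do the elements of the subgroup that it generates
  (\<open>lifts_commute_generate\<close>), and the full preimage of that subgroup is abelian. Three facts follow.

  \<^item> The lifts of \<open>c\<close> commute with each other, so any two elements of \<open>\<langle>c\<rangle>\<close> have commuting lifts:
    the enhanced power graph is always contained in the deep commuting graph.

  \<^item> If \<open>x\<close> and \<open>y\<close> are joined in the deep commuting graph, then \<open>A = \<langle>x, y\<rangle>\<close> has abelian
    preimage. If all such \<open>A\<close> are cyclic, the two graphs agree.

  \<^item> Conversely, let the graphs agree and let \<open>A\<close> have abelian preimage. Then any two elements of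
    \<open>A\<close> generate a cyclic group, and a finite group with this property is itself cyclic
    (\<open>cyclic_if_pairs_generate_cyclic\<close>).
\<close>

section \<open>Cyclic subgroups\<close>

lemma (in group) cyclic_subgroup_iff_generate:
  assumes "subgroup A G"
  shows "cyclic_group (G\<lparr>carrier := A\<rparr>) \<longleftrightarrow> (\<exists>c\<in>A. A = generate G {c})"
proof -
  have "generate (G\<lparr>carrier := A\<rparr>) {c} = generate G {c}" if "c \<in> A" for c
    using generate_consistent[of "{c}" A] that assms by auto
  then show ?thesis
    unfolding cyclic_group_def subgroup_generated_def
    by (intro bex_cong refl) (auto dest: arg_cong[where f = carrier])
qed

lemma (in group) cyclic_pair_iff_generate:
  assumes "x \<in> carrier G" "y \<in> carrier G"
  shows "cyclic_group (subgroup_generated G {x, y}) \<longleftrightarrow>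
    (\<exists>c \<in> generate G {x, y}. generate G {x, y} = generate G {c})"
  using cyclic_subgroup_iff_generate[OF generate_is_subgroup[of "{x, y}"]] assms
  by (simp add: subgroup_generated_def)

text \<open>
  Choose \<open>g \<in> A\<close> such that \<open>\<langle>g\<rangle>\<close> has the largest possible size. For \<open>x \<in> A\<close>, the group
  \<open>\<langle>x, g\<rangle> = \<langle>c\<rangle>\<close> contains \<open>\<langle>g\<rangle>\<close> and is not larger, so that \<open>x \<in> \<langle>c\<rangle> = \<langle>g\<rangle>\<close>.
\<close>
lemma (in group) cyclic_if_pairs_generate_cyclic:
  assumes A: "subgroup A G" "finite A"
    and pairs: "\<And>x y. \<lbrakk>x \<in> A; y \<in> A\<rbrakk> \<Longrightarrow> cyclic_group (subgroup_generated G {x, y})"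
  shows "cyclic_group (G\<lparr>carrier := A\<rparr>)"
proof -
  have AG: "A \<subseteq> carrier G" and ne: "A \<noteq> {}"
    using subgroup.subset[OF A(1)] subgroup.one_closed[OF A(1)] by auto
  have le: "generate G S \<subseteq> A" if "S \<subseteq> A" for S
    using generate_subgroup_incl[OF that A(1)] .
  define size where "size c = card (generate G {c})" for c
  obtain g where g: "g \<in> A" "\<And>c. c \<in> A \<Longrightarrow> size c \<le> size g"
  proof -
    have "Max (size ` A) \<in> size ` A"
      using A(2) ne by simp
    then obtain g where "g \<in> A" "size g = Max (size ` A)"
      by auto
    then show thesis
      using that A(2) by simp
  qed
  have "A \<subseteq> generate G {g}"
  proof
    fix x assume x: "x \<in> A"
    obtain c where c: "c \<in> generate G {x, g}" "generate G {x, g} = generate G {c}"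
      using pairs[OF x g(1)] cyclic_pair_iff_generate[of x g] x g(1) AG by blast
    have cA: "c \<in> A"
      using c(1) le[of "{x, g}"] x g(1) by auto
    have "generate G {g} \<subseteq> generate G {c}"
      using mono_generate[of "{g}" "{x, g}"] c(2) by auto
    moreover have "size c \<le> size g"
      using g(2) cA .
    moreover have "finite (generate G {c})"
      using le[of "{c}"] cA A(2) finite_subset by auto
    ultimately have "generate G {g} = generate G {c}"
      unfolding size_def by (metis card_seteq)
    then show "x \<in> generate G {g}"
      using generate.incl[of x "{x, g}"] c(2) by auto
  qed
  then show ?thesis
    using cyclic_subgroup_iff_generate[OF A(1)] le[of "{g}"] g(1) by blast
qed

section \<open>Commuting lifts in a central extension\<close>

definition lifts_commute ::
  "('b, 'n) monoid_scheme \<Rightarrow> ('b \<Rightarrow> 'a) \<Rightarrow> 'a \<Rightarrow> 'a \<Rightarrow> bool" where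
  "lifts_commute H \<pi> x y \<longleftrightarrow>
     (\<exists>a \<in> carrier H. \<exists>b \<in> carrier H. \<pi> a = x \<and> \<pi> b = y \<and> a \<otimes>\<^bsub>H\<^esub> b = b \<otimes>\<^bsub>H\<^esub> a)"

lemma lifts_commute_sym: "lifts_commute H \<pi> x y \<Longrightarrow> lifts_commute H \<pi> y x"
  unfolding lifts_commute_def by metis

lemma edge_in_enhanced_power_graph_iff:
  "{x, y} \<in> enhanced_power_graph G \<longleftrightarrow>
     x \<in> carrier G \<and> y \<in> carrier G \<and> x \<noteq> y \<and> cyclic_group (subgroup_generated G {x, y})"
  unfolding enhanced_power_graph_def
  by (auto simp: doubleton_eq_iff insert_commute)

locale central_extension_hom = group_hom H G \<pi>
  for H :: "('b, 'n) monoid_scheme" (structure) and G :: "('a, 'm) monoid_scheme" (structure)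
    and \<pi> +
  assumes surj: "\<pi> ` carrier H = carrier G"
    and central: "kernel H G \<pi> \<subseteq> group_center H"
begin

text \<open>
  Write another preimage of \<open>\<pi> a\<close> as \<open>a \<otimes> z\<close>; the factor \<open>z\<close> lies in the kernel, so it is central.
\<close>
lemma commute_change_lift:
  assumes "a \<in> carrier H" "a' \<in> carrier H" "b \<in> carrier H" "\<pi> a = \<pi> a'"
    and comm: "a \<otimes>\<^bsub>H\<^esub> b = b \<otimes>\<^bsub>H\<^esub> a"
  shows "a' \<otimes>\<^bsub>H\<^esub> b = b \<otimes>\<^bsub>H\<^esub> a'"
proof -
  define z where "z = inv\<^bsub>H\<^esub> a \<otimes>\<^bsub>H\<^esub> a'"
  have zH: "z \<in> carrier H" and a': "a' = a \<otimes>\<^bsub>H\<^esub> z"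
    using assms by (auto simp: z_def G.m_assoc[symmetric])
  have "z \<in> kernel H G \<pi>"
    using assms by (simp add: kernel_def z_def)
  then have zb: "z \<otimes>\<^bsub>H\<^esub> b = b \<otimes>\<^bsub>H\<^esub> z"
    using central assms(3) by (auto simp: group_center_def)
  have "a' \<otimes>\<^bsub>H\<^esub> b = (a \<otimes>\<^bsub>H\<^esub> b) \<otimes>\<^bsub>H\<^esub> z"
    using assms(1,3) zH zb by (simp add: a' G.m_assoc)
  also have "\<dots> = b \<otimes>\<^bsub>H\<^esub> a'"
    using assms(1,3) zH comm by (simp add: a' G.m_assoc)
  finally show ?thesis .
qed

lemma lifts_commute_iff_all:
  assumes "a \<in> carrier H" "b \<in> carrier H"
  shows "lifts_commute H \<pi> (\<pi> a) (\<pi> b) \<longleftrightarrow> a \<otimes>\<^bsub>H\<^esub> b = b \<otimes>\<^bsub>H\<^esub> a"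
proof
  assume "lifts_commute H \<pi> (\<pi> a) (\<pi> b)"
  then obtain a' b' where ab': "a' \<in> carrier H" "b' \<in> carrier H" "\<pi> a' = \<pi> a" "\<pi> b' = \<pi> b"
    and comm: "a' \<otimes>\<^bsub>H\<^esub> b' = b' \<otimes>\<^bsub>H\<^esub> a'"
    unfolding lifts_commute_def by blast
  have "a \<otimes>\<^bsub>H\<^esub> b' = b' \<otimes>\<^bsub>H\<^esub> a"
    using commute_change_lift[of a' a b'] assms ab' comm by simp
  then show "a \<otimes>\<^bsub>H\<^esub> b = b \<otimes>\<^bsub>H\<^esub> a"
    using commute_change_lift[of b' b a] assms ab' by simp
qed (use assms in \<open>auto simp: lifts_commute_def\<close>)

lemma lifts_commute_refl:
  assumes "x \<in> carrier G"
  shows "lifts_commute H \<pi> x x"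
proof -
  obtain a where "a \<in> carrier H" "x = \<pi> a"
    using assms surj by blast
  then show ?thesis
    by (simp add: lifts_commute_iff_all)
qed

lemma subgroup_lifts_commute:
  assumes "y \<in> carrier G"
  shows "subgroup {x \<in> carrier G. lifts_commute H \<pi> x y} G"
proof -
  obtain b where b: "b \<in> carrier H" "y = \<pi> b"
    using assms surj by blast
  \<comment> \<open>The set in question is the image of the centralizer of \<open>b\<close>.\<close>
  define C where "C = {a \<in> carrier H. a \<otimes>\<^bsub>H\<^esub> b = b \<otimes>\<^bsub>H\<^esub> a}"
  have "subgroup C H"
  proof (rule G.subgroupI)
    show "C \<noteq> {}"
      using b(1) by (auto simp: C_def intro: exI[of _ "\<one>\<^bsub>H\<^esub>"])
    show "inv\<^bsub>H\<^esub> a \<in> C" if "a \<in> C" for a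
    proof -
      have a: "a \<in> carrier H" "a \<otimes>\<^bsub>H\<^esub> b = b \<otimes>\<^bsub>H\<^esub> a"
        using that by (auto simp: C_def)
      have "inv\<^bsub>H\<^esub> a \<otimes>\<^bsub>H\<^esub> b = inv\<^bsub>H\<^esub> a \<otimes>\<^bsub>H\<^esub> (b \<otimes>\<^bsub>H\<^esub> a) \<otimes>\<^bsub>H\<^esub> inv\<^bsub>H\<^esub> a"
        using a(1) b(1) by (simp add: G.m_assoc)
      also have "\<dots> = b \<otimes>\<^bsub>H\<^esub> inv\<^bsub>H\<^esub> a"
        unfolding a(2)[symmetric] using a(1) b(1) by (simp add: G.m_assoc[symmetric])
      finally show ?thesis
        using a(1) by (simp add: C_def)
    qed
    show "a \<otimes>\<^bsub>H\<^esub> a' \<in> C" if "a \<in> C" "a' \<in> C" for a a'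
    proof -
      have "a \<otimes>\<^bsub>H\<^esub> a' \<otimes>\<^bsub>H\<^esub> b = a \<otimes>\<^bsub>H\<^esub> (b \<otimes>\<^bsub>H\<^esub> a')"
        using that b(1) by (auto simp: C_def G.m_assoc)
      also have "\<dots> = b \<otimes>\<^bsub>H\<^esub> (a \<otimes>\<^bsub>H\<^esub> a')"
        using that b(1) by (simp add: C_def G.m_assoc[symmetric])
      finally show ?thesis
        using that by (simp add: C_def)
    qed
  qed (auto simp: C_def)
  moreover have "{x \<in> carrier G. lifts_commute H \<pi> x y} = \<pi> ` C"
  proof -
    have "C = {a \<in> carrier H. lifts_commute H \<pi> (\<pi> a) y}"
      using b(1) by (auto simp: C_def b(2) lifts_commute_iff_all)
    then show ?thesis
      unfolding surj[symmetric] by blast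
  qed
  ultimately show ?thesis
    using subgroup_img_is_subgroup by simp
qed

text \<open>
  Two passes over the subgroup of the previous lemma: first with \<open>y \<in> S\<close> fixed, which gives the
  claim for \<open>x\<close> in the generated subgroup and \<open>y \<in> S\<close>, then with the roles exchanged.
\<close>
lemma lifts_commute_generate:
  assumes S: "S \<subseteq> carrier G" "\<And>x y. \<lbrakk>x \<in> S; y \<in> S\<rbrakk> \<Longrightarrow> lifts_commute H \<pi> x y"
    and xy: "x \<in> generate G S" "y \<in> generate G S"
  shows "lifts_commute H \<pi> x y"
proof -
  have half: "lifts_commute H \<pi> u s"
    if "s \<in> carrier G" "\<And>t. t \<in> S \<Longrightarrow> lifts_commute H \<pi> t s" "u \<in> generate G S" for u s
    using H.generate_subgroup_incl[OF _ subgroup_lifts_commute, of S s] that S(1) by auto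
  have "lifts_commute H \<pi> s x" if "s \<in> S" for s
    using half[of s x] that S xy(1) by (simp add: lifts_commute_sym subsetD)
  moreover have "x \<in> carrier G"
    using H.generate_in_carrier S(1) xy(1) .
  ultimately show ?thesis
    using half[of x y] xy(2) by (simp add: lifts_commute_sym)
qed

lemma comm_group_preimage_iff:
  assumes A: "subgroup A G"
  shows "comm_group (H\<lparr>carrier := {h \<in> carrier H. \<pi> h \<in> A}\<rparr>) \<longleftrightarrow>
    (\<forall>x\<in>A. \<forall>y\<in>A. lifts_commute H \<pi> x y)"
    (is "comm_group ?B \<longleftrightarrow> ?R")
proof
  assume "comm_group ?B"
  then have "a \<otimes>\<^bsub>H\<^esub> b = b \<otimes>\<^bsub>H\<^esub> a"
    if "a \<in> carrier H" "b \<in> carrier H" "\<pi> a \<in> A" "\<pi> b \<in> A" for a b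
    using comm_monoid.m_comm[OF comm_group.axioms(1), of ?B a b] that by simp
  moreover have "A \<subseteq> \<pi> ` carrier H"
    using subgroup.subset[OF A] surj by simp
  ultimately show ?R
    by (metis (no_types, lifting) imageE lifts_commute_iff_all subsetD)
next
  assume R: ?R
  have "subgroup {h \<in> carrier H. \<pi> h \<in> A} H"
    by (rule G.subgroupI)
      (auto simp: subgroup.m_closed[OF A] subgroup.m_inv_closed[OF A]
        intro!: exI[of _ "\<one>\<^bsub>H\<^esub>"] subgroup.one_closed[OF A])
  then have "group ?B"
    by (rule G.subgroup_imp_group)
  then show "comm_group ?B"
  proof (rule group.group_comm_groupI)
    fix a b assume "a \<in> carrier ?B" "b \<in> carrier ?B"
    then show "a \<otimes>\<^bsub>?B\<^esub> b = b \<otimes>\<^bsub>?B\<^esub> a"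
      using R lifts_commute_iff_all[of a b] by simp
  qed
qed

lemma lifts_commute_if_cyclic:
  assumes xy: "x \<in> carrier G" "y \<in> carrier G"
    and cyc: "cyclic_group (subgroup_generated G {x, y})"
  shows "lifts_commute H \<pi> x y"
proof -
  obtain c where c: "c \<in> generate G {x, y}" "generate G {x, y} = generate G {c}"
    using cyc H.cyclic_pair_iff_generate[OF xy] by blast
  have "c \<in> carrier G"
    using H.generate_in_carrier[of "{x, y}"] xy c(1) by auto
  moreover have "x \<in> generate G {c}" "y \<in> generate G {c}"
    using c(2) generate.incl[of _ "{x, y}" G] by auto
  ultimately show ?thesis
    using lifts_commute_generate[of "{c}" x y] lifts_commute_refl by auto
qed

text \<open>
  Only one implication between the two adjacency conditions remains, since the other one always
  holds. Quantifying over all pairs rather than pairs of distinct vertices changes nothing: a single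
  element generates a cyclic group.
\<close>
lemma graphs_eq_iff:
  "deep_commuting_graph G H \<pi> = enhanced_power_graph G \<longleftrightarrow>
    (\<forall>x\<in>carrier G. \<forall>y\<in>carrier G.
       lifts_commute H \<pi> x y \<longrightarrow> cyclic_group (subgroup_generated G {x, y}))"
    (is "?D = ?E \<longleftrightarrow> ?R")
proof
  assume eq: "?D = ?E"
  show ?R
  proof (intro ballI impI)
    fix x y assume xy: "x \<in> carrier G" "y \<in> carrier G" "lifts_commute H \<pi> x y"
    show "cyclic_group (subgroup_generated G {x, y})"
    proof (cases "x = y")
      case True
      then show ?thesis
        using H.cyclic_group_generated by simp
    next
      case False
      then have "{x, y} \<in> ?E"
        using xy unfolding eq[symmetric] deep_commuting_graph_def lifts_commute_def by blast
      then show ?thesis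
        by (simp add: edge_in_enhanced_power_graph_iff)
    qed
  qed
next
  assume R: ?R
  have edge: "x \<in> carrier G \<and> y \<in> carrier G \<and> x \<noteq> y \<and> lifts_commute H \<pi> x y \<longleftrightarrow>
      x \<in> carrier G \<and> y \<in> carrier G \<and> x \<noteq> y \<and> cyclic_group (subgroup_generated G {x, y})"
    for x y
    using R lifts_commute_if_cyclic[of x y] by blast
  show "?D = ?E"
    unfolding deep_commuting_graph_def enhanced_power_graph_def lifts_commute_def[symmetric] edge ..
qed

theorem graphs_eq_iff_abelian_preimage_imp_cyclic:
  assumes fin: "finite (carrier G)"
  shows "deep_commuting_graph G H \<pi> = enhanced_power_graph G \<longleftrightarrow>
    (\<forall>A. subgroup A G \<longrightarrow> comm_group (H\<lparr>carrier := {h \<in> carrier H. \<pi> h \<in> A}\<rparr>) \<longrightarrow>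
       cyclic_group (G\<lparr>carrier := A\<rparr>))"
    (is "_ \<longleftrightarrow> ?P")
  unfolding graphs_eq_iff
proof (intro iffI allI ballI impI)
  fix A assume
    pairs: "\<forall>x\<in>carrier G. \<forall>y\<in>carrier G.
      lifts_commute H \<pi> x y \<longrightarrow> cyclic_group (subgroup_generated G {x, y})"
    and A: "subgroup A G"
    and comm: "comm_group (H\<lparr>carrier := {h \<in> carrier H. \<pi> h \<in> A}\<rparr>)"
  have AG: "A \<subseteq> carrier G"
    using subgroup.subset[OF A] .
  show "cyclic_group (G\<lparr>carrier := A\<rparr>)"
  proof (rule H.cyclic_if_pairs_generate_cyclic[OF A])
    show "finite A"
      using AG fin finite_subset by blast
    show "cyclic_group (subgroup_generated G {x, y})" if "x \<in> A" "y \<in> A" for x y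
      using that AG pairs comm comm_group_preimage_iff[OF A] by blast
  qed
next
  fix x y assume P: ?P
    and xy: "x \<in> carrier G" "y \<in> carrier G" "lifts_commute H \<pi> x y"
  have sub: "subgroup (generate G {x, y}) G"
    using H.generate_is_subgroup xy by simp
  have "lifts_commute H \<pi> u v" if "u \<in> generate G {x, y}" "v \<in> generate G {x, y}" for u v
  proof (rule lifts_commute_generate[OF _ _ that])
    show "{x, y} \<subseteq> carrier G"
      using xy by simp
    show "lifts_commute H \<pi> s t" if "s \<in> {x, y}" "t \<in> {x, y}" for s t
      using that xy lifts_commute_refl lifts_commute_sym[OF xy(3)] by auto
  qed
  then have "cyclic_group (G\<lparr>carrier := generate G {x, y}\<rparr>)"
    using P sub comm_group_preimage_iff[OF sub] by blast
  then show "cyclic_group (subgroup_generated G {x, y})"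
    using xy by (simp add: subgroup_generated_def)
qed

end

section \<open>The two graphs of a Schur cover\<close>

theorem theorem4p3:
  fixes G :: "('a, 'm) monoid_scheme" and H :: "('b, 'n) monoid_scheme" and \<pi> :: "'b \<Rightarrow> 'a"
  assumes "group G" and "finite (carrier G)"
    and "schur_cover G H \<pi>"
  shows "deep_commuting_graph G H \<pi> = enhanced_power_graph G \<longleftrightarrow>
    (\<forall>A B. subgroup A G \<longrightarrow> B = {h \<in> carrier H. \<pi> h \<in> A} \<longrightarrow>
       comm_group (H\<lparr>carrier := B\<rparr>) \<longrightarrow> cyclic_group (G\<lparr>carrier := A\<rparr>))"
proof -
  have "central_extension G H \<pi>"
    using assms(3) by (simp add: schur_cover_def stem_extension_def)
  then interpret central_extension_hom H G \<pi>
    by (simp add: central_extension_def epi_def central_extension_hom_def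
      central_extension_hom_axioms_def group_hom_def group_hom_axioms_def)
  show ?thesis
    using graphs_eq_iff_abelian_preimage_imp_cyclic[OF assms(2)] by simp
qed

end
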